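(* Let $A\in\mathbb{R}^{m\times n}$ with $m<n$ have full row rank and let $b\in\mathbb{R}^m$, $b\neq 0$. Then there exists a constant $a^{**}>0$, depending on $A$ and $b$, such that for every $a>a^{**}$, every optimal solution to the problem $(FP_a)$: $\min_{x\in\mathbb{R}^n}P_a(x)$ subject to $Ax=b$, is also an optimal solution to the problem $(P_0)$: $\min_{x\in\mathbb{R}^n}\|x\|_0$ subject to $Ax=b$.
   Context: For $a>0$ and $x\in\mathbb{R}^n$, $P_a(x)=\sum_{i=1}^n p_a(x_i)$ with $p_a(t)=\frac{a|t|}{1+a|t|}$. $\|x\|_0$ denotes the number of nonzero entries of $x$. *)

theory Defs
  imports "HOL-Analysis.Analysis"
begin

definition frac_penalty :: "real \<Rightarrow> real \<Rightarrow> real"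
  where "frac_penalty a t = a * \<bar>t\<bar> / (1 + a * \<bar>t\<bar>)"

definition P_frac :: "real \<Rightarrow> real ^ 'n \<Rightarrow> real"
  where "P_frac a x = (\<Sum>i\<in>UNIV. frac_penalty a (x $ i))"

definition l0_norm :: "real ^ 'n \<Rightarrow> nat"
  where "l0_norm x = card {i. x $ i \<noteq> 0}"

definition optimal_FP :: "real \<Rightarrow> real ^ 'n ^ 'm \<Rightarrow> real ^ 'm \<Rightarrow> real ^ 'n \<Rightarrow> bool"
  where "optimal_FP a A b x \<longleftrightarrow> is_arg_min (P_frac a) (\<lambda>y. A *v y = b) x"

definition optimal_P0 :: "real ^ 'n ^ 'm \<Rightarrow> real ^ 'm \<Rightarrow> real ^ 'n \<Rightarrow> bool"
  where "optimal_P0 A b x \<longleftrightarrow> is_arg_min l0_norm (\<lambda>y. A *v y = b) x"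

end

theory Submission
  imports Defs
begin

text \<open>
  On an orthant the penalty is strictly concave, so a minimiser cannot be moved both ways along a
  kernel direction of \<open>A\<close> supported in its own support; hence it is a basic solution. There
  are finitely many basic solutions, so their nonzero entries are bounded below by some \<open>r > 0\<close>.
  Then each nonzero entry of a minimiser costs at least \<open>a r / (1 + a r)\<close>, and once
  \<open>a r\<close> exceeds the dimension, a feasible point with fewer nonzero entries, each costing
  at most 1, would be cheaper.
\<close>

lemma frac_penalty_zero [simp]: "frac_penalty a 0 = 0"
  by (simp add: frac_penalty_def)

lemma frac_penalty_le_one: "a \<ge> 0 \<Longrightarrow> frac_penalty a t \<le> 1"
  by (simp add: frac_penalty_def divide_le_eq add_pos_nonneg)

lemma frac_penalty_eq: "a \<ge> 0 \<Longrightarrow> frac_penalty a t = 1 - 1 / (1 + a * \<bar>t\<bar>)"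
  by (simp add: frac_penalty_def field_simps add_pos_nonneg add_nonneg_eq_0_iff)

lemma frac_penalty_mono:
  assumes "a \<ge> 0" "0 \<le> s" "s \<le> \<bar>t\<bar>"
  shows "frac_penalty a s \<le> frac_penalty a t"
proof -
  have "a * s \<le> a * \<bar>t\<bar>" "0 \<le> a * s"
    using assms by (auto intro: mult_left_mono)
  then have "1 / (1 + a * \<bar>t\<bar>) \<le> 1 / (1 + a * s)"
    by (intro frac_le) auto
  then show ?thesis
    using assms by (simp add: frac_penalty_eq)
qed

text \<open>This is strict convexity of the reciprocal at the midpoint \<open>c\<close>. Both
  denominators are positive, and clearing them leaves \<open>d * d > 0\<close>.\<close>

lemma sum_inverse_symmetric_gt:
  fixes c d :: real
  assumes "d \<noteq> 0" "\<bar>d\<bar> < c"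
  shows "2 / c < 1 / (c + d) + 1 / (c - d)"
proof -
  have "d * d > 0" "0 < c" "0 < c + d" "0 < c - d"
    using assms by (auto simp: zero_less_mult_iff)
  then show ?thesis
    by (simp add: divide_simps) (simp add: algebra_simps)
qed

text \<open>The bound on \<open>s\<close> keeps \<open>u + s\<close> and \<open>u - s\<close> from
  crossing the kink at 0, so only one concave branch of the penalty is involved.\<close>

lemma frac_penalty_midpoint_strict:
  assumes a: "a > 0" and s: "s \<noteq> 0" "\<bar>s\<bar> \<le> \<bar>u\<bar>"
  shows "frac_penalty a (u + s) + frac_penalty a (u - s) < 2 * frac_penalty a u"
proof -
  \<comment> \<open>The sign of \<open>d\<close> follows that of \<open>u\<close>, so that the two
    denominators become \<open>c + d\<close> and \<open>c - d\<close> with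
    \<open>c = 1 + a * \<bar>u\<bar>\<close>.\<close>
  define d where "d = (if u \<ge> 0 then a * s else - (a * s))"
  have "\<bar>u + s\<bar> = (if u \<ge> 0 then u + s else - u - s)"
    "\<bar>u - s\<bar> = (if u \<ge> 0 then u - s else - u + s)"
    using s by auto
  then have eqs: "1 + a * \<bar>u + s\<bar> = (1 + a * \<bar>u\<bar>) + d" "1 + a * \<bar>u - s\<bar> = (1 + a * \<bar>u\<bar>) - d"
    by (auto simp: d_def algebra_simps)
  have "\<bar>d\<bar> = a * \<bar>s\<bar>"
    using a by (simp add: d_def abs_mult)
  also have "\<dots> \<le> a * \<bar>u\<bar>"
    using a s by simp
  finally have "\<bar>d\<bar> < 1 + a * \<bar>u\<bar>"
    by simp
  moreover have "d \<noteq> 0"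
    using a s by (simp add: d_def)
  ultimately show ?thesis
    using sum_inverse_symmetric_gt[of d "1 + a * \<bar>u\<bar>"] a
    by (simp add: frac_penalty_eq eqs)
qed

lemma P_frac_le_l0_norm:
  assumes "a \<ge> 0"
  shows "P_frac a x \<le> real (l0_norm x)"
proof -
  have "P_frac a x = (\<Sum>i | x $ i \<noteq> 0. frac_penalty a (x $ i))"
    unfolding P_frac_def by (rule sum.mono_neutral_right) auto
  also have "\<dots> \<le> real (card {i. x $ i \<noteq> 0}) * 1"
    by (rule sum_bounded_above) (simp add: assms frac_penalty_le_one)
  finally show ?thesis
    by (simp add: l0_norm_def)
qed

lemma P_frac_ge_l0_norm:
  assumes "a \<ge> 0" "r \<ge> 0" "\<And>i. x $ i \<noteq> 0 \<Longrightarrow> r \<le> \<bar>x $ i\<bar>"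
  shows "real (l0_norm x) * frac_penalty a r \<le> P_frac a x"
proof -
  have "real (card {i. x $ i \<noteq> 0}) * frac_penalty a r \<le> (\<Sum>i | x $ i \<noteq> 0. frac_penalty a (x $ i))"
    by (rule sum_bounded_below) (simp add: assms frac_penalty_mono)
  also have "\<dots> = P_frac a x"
    unfolding P_frac_def by (rule sum.mono_neutral_left) auto
  finally show ?thesis
    by (simp add: l0_norm_def)
qed

lemma P_frac_midpoint_strict:
  fixes x h :: "real ^ 'n"
  assumes a: "a > 0" and h: "h \<noteq> 0" and le: "\<And>i. \<bar>h $ i\<bar> \<le> \<bar>x $ i\<bar>"
  shows "P_frac a (x + h) + P_frac a (x - h) < 2 * P_frac a x"
proof -
  obtain j where j: "h $ j \<noteq> 0"
    using h by (metis vec_eq_iff zero_index)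
  have "(\<Sum>i\<in>UNIV. frac_penalty a (x $ i + h $ i) + frac_penalty a (x $ i - h $ i))
      < (\<Sum>i\<in>UNIV. 2 * frac_penalty a (x $ i))"
  proof (rule sum_strict_mono_ex1)
    show "\<forall>i\<in>UNIV. frac_penalty a (x $ i + h $ i) + frac_penalty a (x $ i - h $ i)
        \<le> 2 * frac_penalty a (x $ i)"
    proof
      fix i
      show "frac_penalty a (x $ i + h $ i) + frac_penalty a (x $ i - h $ i)
          \<le> 2 * frac_penalty a (x $ i)"
        using frac_penalty_midpoint_strict[OF a _ le, of i] by (cases "h $ i = 0") auto
    qed
    show "\<exists>i\<in>UNIV. frac_penalty a (x $ i + h $ i) + frac_penalty a (x $ i - h $ i)
        < 2 * frac_penalty a (x $ i)"
      using frac_penalty_midpoint_strict[OF a j le] by blast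
  qed simp
  then show ?thesis
    by (simp add: P_frac_def sum.distrib sum_distrib_left)
qed

text \<open>Equivalently, the columns of \<open>A\<close> indexed by the support of \<open>x\<close> are linearly independent.\<close>

definition basic_solution :: "real ^ 'n ^ 'm \<Rightarrow> real ^ 'm \<Rightarrow> real ^ 'n \<Rightarrow> bool"
  where "basic_solution A b x \<longleftrightarrow>
    A *v x = b \<and> (\<forall>h. A *v h = 0 \<and> (\<forall>i. x $ i = 0 \<longrightarrow> h $ i = 0) \<longrightarrow> h = 0)"

text \<open>A basic solution is determined by its support: two with the same support differ by a
  kernel vector living on that support, which must vanish. There are only finitely many
  supports.\<close>

lemma finite_basic_solutions: "finite {x. basic_solution A b x}"
proof (rule inj_on_finite)
  show "inj_on (\<lambda>x. {i. x $ i \<noteq> 0}) {x. basic_solution A b x}"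
  proof (rule inj_onI)
    fix x y
    assume x: "x \<in> {x. basic_solution A b x}" and y: "y \<in> {x. basic_solution A b x}"
      and supp: "{i. x $ i \<noteq> 0} = {i. y $ i \<noteq> 0}"
    have "A *v (x - y) = 0"
      using x y by (simp add: basic_solution_def matrix_vector_mult_diff_distrib)
    moreover have "\<forall>i. x $ i = 0 \<longrightarrow> (x - y) $ i = 0"
      using supp by auto
    ultimately have "x - y = 0"
      using x by (simp only: basic_solution_def mem_Collect_eq)
    then show "x = y"
      by simp
  qed
qed (rule subset_UNIV, simp)

text \<open>The bound \<open>r\<close> depends on \<open>A\<close> and \<open>b\<close> but not on
  \<open>a\<close>, which is what makes a threshold uniform in \<open>a\<close> possible.\<close>

lemma basic_solutions_entries_bounded_below:
  obtains r where "r > 0" "\<And>x i. basic_solution A b x \<Longrightarrow> x $ i \<noteq> 0 \<Longrightarrow> r \<le> \<bar>x $ i\<bar>"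
proof -
  define E where "E = (\<lambda>(x, i). \<bar>x $ i\<bar>) ` ({x. basic_solution A b x} \<times> UNIV) - {0}"
  have fin: "finite E"
    by (simp add: E_def finite_basic_solutions)
  show thesis
  proof (rule that)
    \<comment> \<open>Inserting 1 keeps the minimum meaningful when \<open>E\<close> is
      empty.\<close>
    show "Min (insert 1 E) > 0"
      using fin by (auto simp: E_def)
    show "Min (insert 1 E) \<le> \<bar>x $ i\<bar>" if "basic_solution A b x" "x $ i \<noteq> 0" for x i
      using that by (intro Min_le) (force simp: fin, force simp: E_def)
  qed
qed

lemma optimal_FP_imp_basic_solution:
  assumes a: "a > 0" and opt: "optimal_FP a A b x"
  shows "basic_solution A b x"
proof -
  have feas: "A *v x = b" and min: "\<And>y. A *v y = b \<Longrightarrow> P_frac a x \<le> P_frac a y"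
    using opt by (auto simp: optimal_FP_def is_arg_min_def not_less)
  have "h = 0" if Ah: "A *v h = 0" and supp: "\<forall>i. x $ i = 0 \<longrightarrow> h $ i = 0" for h
  proof (rule ccontr)
    assume h: "h \<noteq> 0"
    \<comment> \<open>Rescaling \<open>h\<close> to norm \<open>m\<close> makes every entry of
      \<open>k\<close> at most the smallest nonzero modulus in \<open>x\<close>. Then
      \<open>x + k\<close> and \<open>x - k\<close> are both feasible, and one of them would be
      cheaper than \<open>x\<close>.\<close>
    define m where "m = Min (insert 1 ((\<lambda>i. \<bar>x $ i\<bar>) ` {i. x $ i \<noteq> 0}))"
    define k where "k = (m / norm h) *\<^sub>R h"
    have m: "m > 0"
      by (auto simp: m_def)
    have "\<bar>k $ i\<bar> \<le> \<bar>x $ i\<bar>" for i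
    proof (cases "x $ i = 0")
      case False
      then have "m \<le> \<bar>x $ i\<bar>"
        unfolding m_def by (intro Min_le) auto
      moreover have "\<bar>k $ i\<bar> \<le> norm k"
        by (rule component_le_norm_cart)
      moreover have "norm k = m"
        using h m by (simp add: k_def)
      ultimately show ?thesis
        by simp
    qed (use supp in \<open>simp add: k_def\<close>)
    moreover have "k \<noteq> 0"
      using h m by (simp add: k_def)
    ultimately have "P_frac a (x + k) + P_frac a (x - k) < 2 * P_frac a x"
      using a by (intro P_frac_midpoint_strict)
    moreover have "A *v k = 0"
      by (simp add: k_def Ah matrix_vector_mult_scaleR)
    ultimately show False
      using min[of "x + k"] min[of "x - k"] feas
      by (simp add: matrix_vector_mult_diff_distrib matrix_vector_right_distrib)
  qed
  then show ?thesis
    using feas by (simp add: basic_solution_def)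
qed

theorem theorem2:
  fixes A :: "real ^ 'n ^ 'm" and b :: "real ^ 'm"
  assumes "CARD('m) < CARD('n)"
    and "rank A = CARD('m)"
    and "b \<noteq> 0"
  shows "\<exists>a0 > 0. \<forall>a > a0. \<forall>x. optimal_FP a A b x \<longrightarrow> optimal_P0 A b x"
proof -
  obtain r where r: "r > 0"
    and lower: "\<And>x i. basic_solution A b x \<Longrightarrow> x $ i \<noteq> 0 \<Longrightarrow> r \<le> \<bar>x $ i\<bar>"
    using basic_solutions_entries_bounded_below by blast
  \<comment> \<open>The threshold is chosen so that \<open>a * r\<close> exceeds the
    dimension.\<close>
  have "optimal_P0 A b x" if a_gt: "a > real CARD('n) / r" and opt: "optimal_FP a A b x" for a x
  proof -
    have "real CARD('n) / r > 0"
      using r by simp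
    with a_gt have a: "a > 0"
      by linarith
    have feas: "A *v x = b" and min: "\<And>y. A *v y = b \<Longrightarrow> P_frac a x \<le> P_frac a y"
      using opt by (auto simp: optimal_FP_def is_arg_min_def not_less)
    have "\<not> l0_norm y < l0_norm x" if y: "A *v y = b" for y
    proof
      assume less: "l0_norm y < l0_norm x"
      have "real (l0_norm x) * frac_penalty a r \<le> P_frac a x"
        using a r lower[OF optimal_FP_imp_basic_solution[OF a opt]]
        by (intro P_frac_ge_l0_norm) auto
      also have "\<dots> \<le> P_frac a y"
        by (rule min[OF y])
      also have "\<dots> \<le> real (l0_norm y)"
        using a by (intro P_frac_le_l0_norm) simp
      \<comment> \<open>Counts are integers, so a strict improvement gains at least 1, whereas
        rounding each nonzero entry's cost up to 1 loses at most \<open>1 / (1 + a * r)\<close> per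
        entry.\<close>
      also have "\<dots> \<le> real (l0_norm x) - 1"
        using less by linarith
      finally have "1 \<le> real (l0_norm x) * (1 - frac_penalty a r)"
        by (simp add: algebra_simps)
      also have "\<dots> = real (l0_norm x) / (1 + a * r)"
        using a r by (simp add: frac_penalty_eq)
      finally have "1 + a * r \<le> real (l0_norm x)"
        using a r by (simp add: le_divide_eq add_pos_pos)
      also have "\<dots> \<le> real CARD('n)"
        unfolding l0_norm_def by (simp add: card_mono)
      also have "\<dots> < a * r"
        using a_gt r by (simp add: divide_less_eq)
      finally show False
        by simp
    qed
    then show ?thesis
      using feas by (auto simp: optimal_P0_def is_arg_min_def)
  qed
  then show ?thesis
    using r by (intro exI[of _ "real CARD('n) / r"]) simp
qed

end
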